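(* Let $I$ and $J$ be arbitrary (possibly infinite) index sets, and let $R_i$ for $i\in I$ and $S_j$ for $j\in J$ be nonzero directly indecomposable unital rings (not necessarily commutative). Then every multiplicative-monoid isomorphism $$\Phi:\prod_{i\in I}(R_i,\cdot)\to\prod_{j\in J}(S_j,\cdot)$$ is monomial. In particular, $|I|=|J|$, and there is a unique bijection $\sigma:I\to J$ such that, after reindexing the factors by $\sigma$, the isomorphism $\Phi$ is induced by multiplicative-monoid isomorphisms $(R_i,\cdot)\to(S_{\sigma(i)},\cdot)$ ($i\in I$).
   Context: For a unital ring $R$, $(R,\cdot)$ denotes its multiplicative monoid; multiplicative-monoid isomorphisms are not assumed to preserve addition. A nonzero unital ring is directly indecomposable if it is not isomorphic, as a ring, to a product $R_1\times R_2$ of two nonzero unital rings. For products of monoids $M=\prod_{i\in I}M_i$ and $N=\prod_{j\in J}N_j$, let $\iota_i:M_i\to M$ send $x$ to the tuple with $i$-th coordinate $x$ and all other coordinates $1$, let $\pi_i:M\to M_i$ be the $i$-th projection, and let $\iota'_j$, $\pi'_j$ be the analogous maps for $N$. An isomorphism $\Phi:M\to N$ is monomial if there exist a bijection $\sigma:I\to J$ and isomorphisms $\phi_i:M_i\to N_{\sigma(i)}$ such that $\Phi\circ\iota_i=\iota'_{\sigma(i)}\circ\phi_i$ and $\pi'_{\sigma(i)}\circ\Phi=\phi_i\circ\pi_i$ for every $i\in I$; in this situation $\Phi$ is said to be induced by the $\phi_i$. *)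

theory Defs
  imports "HOL-Algebra.Algebra" "HOL-Library.Equipollence"
begin

definition nonzero_ring :: "('a, 'm) ring_scheme \<Rightarrow> bool" where
  "nonzero_ring R \<longleftrightarrow> ring R \<and> carrier R \<noteq> {\<zero>\<^bsub>R\<^esub>}"

text \<open>HOL cannot quantify over types inside a definition, so the two factors are rings with
  elements in the type of elements of \<open>R\<close>. This is no restriction: see
  \<open>directly_indecomposable_any_type\<close> below.\<close>

definition directly_indecomposable :: "('a, 'm) ring_scheme \<Rightarrow> bool" where
  "directly_indecomposable R \<longleftrightarrow> nonzero_ring R \<and>
     \<not> (\<exists>(A :: 'a ring) (B :: 'a ring). nonzero_ring A \<and> nonzero_ring B \<and> R \<simeq> RDirProd A B)"

lemma nonzero_ring_image:
  assumes "nonzero_ring A" "inj_on f (carrier A)"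
  shows "nonzero_ring (image_ring f A)" "f \<in> ring_iso A (image_ring f A)"
proof -
  have A: "ring A" "carrier A \<noteq> {\<zero>\<^bsub>A\<^esub>}" using assms(1) by (auto simp: nonzero_ring_def)
  show iso: "f \<in> ring_iso A (image_ring f A)"
    using inj_imp_image_ring_iso[OF assms(2)] .
  have "ring (image_ring f A)"
    using ring.inj_imp_image_ring_is_ring[OF A(1) assms(2)] .
  moreover have "f ` carrier A \<noteq> {f \<zero>\<^bsub>A\<^esub>}"
  proof
    assume "f ` carrier A = {f \<zero>\<^bsub>A\<^esub>}"
    moreover have "\<zero>\<^bsub>A\<^esub> \<in> carrier A" using A(1) by (simp add: ring.ring_simprules)
    ultimately have "carrier A = {\<zero>\<^bsub>A\<^esub>}"
      using assms(2) by (auto simp: inj_on_def)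
    with A(2) show False by simp
  qed
  ultimately show "nonzero_ring (image_ring f A)"
    by (simp add: nonzero_ring_def image_ring_carrier image_ring_zero)
qed

lemma directly_indecomposable_any_type:
  fixes R :: "('a, 'm) ring_scheme" and A :: "('b, 'n) ring_scheme" and B :: "('c, 'k) ring_scheme"
  assumes R: "directly_indecomposable R" and A: "nonzero_ring A" and B: "nonzero_ring B"
  shows "\<not> R \<simeq> RDirProd A B"
proof
  assume "R \<simeq> RDirProd A B"
  then obtain f where f: "f \<in> ring_iso R (RDirProd A B)"
    by (auto simp: is_ring_iso_def)
  define g where "g = inv_into (carrier R) f"
  have "bij_betw f (carrier R) (carrier A \<times> carrier B)"
    using f by (simp add: ring_iso_def RDirProd_carrier)
  then have g: "inj_on g (carrier A \<times> carrier B)"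
    unfolding g_def using bij_betw_inv_into bij_betw_def by blast
  have z: "\<zero>\<^bsub>A\<^esub> \<in> carrier A" "\<zero>\<^bsub>B\<^esub> \<in> carrier B"
    using A B by (auto simp: nonzero_ring_def ring.ring_simprules)
  have a: "inj_on (\<lambda>x. g (x, \<zero>\<^bsub>B\<^esub>)) (carrier A)" and b: "inj_on (\<lambda>y. g (\<zero>\<^bsub>A\<^esub>, y)) (carrier B)"
    using g z by (auto simp: inj_on_def)
  note A' = nonzero_ring_image[OF A a] and B' = nonzero_ring_image[OF B b]
  have "R \<simeq> RDirProd (image_ring (\<lambda>x. g (x, \<zero>\<^bsub>B\<^esub>)) A) (image_ring (\<lambda>y. g (\<zero>\<^bsub>A\<^esub>, y)) B)"
    using ring_iso_set_trans[OF f RDirProd_iso6[OF A'(2) B'(2)]] by (auto simp: is_ring_iso_def)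
  then show False using R A'(1) B'(1)
    unfolding directly_indecomposable_def by blast
qed

text \<open>Families of monoids are passed to \<open>product_group\<close>, which needs no inverses. A ring record extends
  a monoid record, so for a family \<open>R\<close> of rings \<open>product_group I R\<close> is the product of the
  multiplicative monoids and \<open>iso\<close> only concerns multiplication. As \<open>iso\<close> asks for bijectivity,
  the identity element is preserved as well. Elements of a product over \<open>I\<close> are
  functions that are \<open>undefined\<close> outside \<open>I\<close>.\<close>

lemma product_group_monoid:
  assumes "\<And>i. i \<in> I \<Longrightarrow> monoid (M i)"
  shows "monoid (product_group I M)"
  using assms by (intro monoidI)
    (auto simp: product_group_def PiE_iff monoid.m_closed monoid.one_closed monoid.m_assoc
      monoid.l_one monoid.r_one extensional_def fun_eq_iff)

lemma iso_monoid_one: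
  assumes "monoid M" "monoid N" "h \<in> iso M N"
  shows "h \<one>\<^bsub>M\<^esub> = \<one>\<^bsub>N\<^esub>"
proof -
  interpret M: monoid M by fact
  interpret N: monoid N by fact
  have h: "h \<in> hom M N" "h ` carrier M = carrier N"
    using assms(3) by (auto simp: iso_def bij_betw_def)
  obtain x where x: "x \<in> carrier M" "h x = \<one>\<^bsub>N\<^esub>"
    using h(2) N.one_closed by (metis imageE)
  have "h \<one>\<^bsub>M\<^esub> = h \<one>\<^bsub>M\<^esub> \<otimes>\<^bsub>N\<^esub> h x"
    using x(2) hom_in_carrier[OF h(1) M.one_closed] by simp
  also have "\<dots> = h x"
    using x(1) h(1) hom_mult[OF h(1) M.one_closed x(1)] by simp
  finally show ?thesis using x(2) by simp
qed

definition factor_incl ::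
  "'i set \<Rightarrow> ('i \<Rightarrow> ('a, 'm) monoid_scheme) \<Rightarrow> 'i \<Rightarrow> 'a \<Rightarrow> ('i \<Rightarrow> 'a)" where
  "factor_incl I M i x = (\<lambda>k\<in>I. if k = i then x else \<one>\<^bsub>M k\<^esub>)"

definition induced_by ::
  "'i set \<Rightarrow> ('i \<Rightarrow> ('a, 'm) monoid_scheme) \<Rightarrow> 'j set \<Rightarrow> ('j \<Rightarrow> ('b, 'n) monoid_scheme) \<Rightarrow>
   (('i \<Rightarrow> 'a) \<Rightarrow> ('j \<Rightarrow> 'b)) \<Rightarrow> ('i \<Rightarrow> 'j) \<Rightarrow> ('i \<Rightarrow> 'a \<Rightarrow> 'b) \<Rightarrow> bool" where
  "induced_by I M J N \<Phi> \<sigma> \<phi> \<longleftrightarrow>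
     bij_betw \<sigma> I J \<and>
     (\<forall>i\<in>I. \<phi> i \<in> iso (M i) (N (\<sigma> i)) \<and>
       (\<forall>x\<in>carrier (M i). \<Phi> (factor_incl I M i x) = factor_incl J N (\<sigma> i) (\<phi> i x)) \<and>
       (\<forall>x\<in>carrier (product_group I M). \<Phi> x (\<sigma> i) = \<phi> i (x i)))"

definition monomial_iso ::
  "'i set \<Rightarrow> ('i \<Rightarrow> ('a, 'm) monoid_scheme) \<Rightarrow> 'j set \<Rightarrow> ('j \<Rightarrow> ('b, 'n) monoid_scheme) \<Rightarrow>
   (('i \<Rightarrow> 'a) \<Rightarrow> ('j \<Rightarrow> 'b)) \<Rightarrow> bool" where
  "monomial_iso I M J N \<Phi> \<longleftrightarrow>
     \<Phi> \<in> iso (product_group I M) (product_group J N) \<and>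
     (\<exists>\<sigma> \<phi>. induced_by I M J N \<Phi> \<sigma> \<phi>)"

end

theory Submission
  imports Defs
begin

text \<open>The central idempotents and their order \<open>f \<le> e \<longleftrightarrow> f e = f\<close> are visible in the
  multiplicative monoid. A directly indecomposable ring has only the central idempotents \<open>0\<close> and
  \<open>1\<close>, so the atoms in a product of such rings are the tuples \<open>e i\<close> with entry \<open>1\<close> at \<open>i\<close> and \<open>0\<close>
  elsewhere. Hence \<open>\<Phi>\<close> maps \<open>e i\<close> to some \<open>e (\<sigma> i)\<close>, and as \<open>e (\<sigma> i) \<Phi>(x) = \<Phi>(e i x)\<close>, the
  coordinate \<open>\<sigma> i\<close> of \<open>\<Phi>(x)\<close> depends only on the coordinate \<open>i\<close> of \<open>x\<close>.\<close>

section \<open>Central idempotents and their atoms in a monoid\<close>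

definition central_idempotents :: "('a, 'm) monoid_scheme \<Rightarrow> 'a set" where
  "central_idempotents G =
     {e \<in> carrier G. e \<otimes>\<^bsub>G\<^esub> e = e \<and> (\<forall>x\<in>carrier G. e \<otimes>\<^bsub>G\<^esub> x = x \<otimes>\<^bsub>G\<^esub> e)}"

text \<open>A multiplicative substitute for the zero of a ring. It is applied to central idempotents
  in \<open>central_atoms\<close>, where the condition on one side gives the other.\<close>

definition absorbing :: "('a, 'm) monoid_scheme \<Rightarrow> 'a \<Rightarrow> bool" where
  "absorbing G z \<longleftrightarrow> (\<forall>x\<in>carrier G. z \<otimes>\<^bsub>G\<^esub> x = z)"

definition central_atoms :: "('a, 'm) monoid_scheme \<Rightarrow> 'a set" where
  "central_atoms G =
     {e \<in> central_idempotents G. \<not> absorbing G e \<and>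
       (\<forall>f\<in>central_idempotents G. f \<otimes>\<^bsub>G\<^esub> e = f \<longrightarrow> absorbing G f \<or> f = e)}"

lemma central_idempotentsD:
  assumes "e \<in> central_idempotents G"
  shows "e \<in> carrier G" "e \<otimes>\<^bsub>G\<^esub> e = e" "x \<in> carrier G \<Longrightarrow> x \<otimes>\<^bsub>G\<^esub> e = e \<otimes>\<^bsub>G\<^esub> x"
  using assms unfolding central_idempotents_def by auto

text \<open>All three notions are built from equations between products, with quantifiers over the
  carrier. Surjectivity of \<open>h\<close> turns quantifiers over \<open>carrier H\<close> into
  quantifiers over \<open>carrier G\<close>, and injectivity pulls the equations back; closure of
  \<open>G\<close> under products is what lets injectivity apply to both sides.\<close>

lemma iso_image_central_atoms:
  assumes G: "monoid G" and h: "h \<in> iso G H"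
  shows "h ` central_atoms G = central_atoms H"
proof -
  interpret monoid G by fact
  have hom: "h (x \<otimes>\<^bsub>G\<^esub> y) = h x \<otimes>\<^bsub>H\<^esub> h y" if "x \<in> carrier G" "y \<in> carrier G" for x y
    using h that by (auto simp: iso_def hom_def)
  have inj: "h x = h y \<longleftrightarrow> x = y" if "x \<in> carrier G" "y \<in> carrier G" for x y
    using h that by (auto simp: iso_def bij_betw_def inj_on_def)
  have im: "carrier H = h ` carrier G"
    using h by (auto simp: iso_def bij_betw_def)
  have idem: "h e \<in> central_idempotents H \<longleftrightarrow> e \<in> central_idempotents G" if "e \<in> carrier G" for e
    using that by (simp add: central_idempotents_def im hom[symmetric] inj)
  have abs: "absorbing H (h e) \<longleftrightarrow> absorbing G e" if "e \<in> carrier G" for e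
    using that by (simp add: absorbing_def im hom[symmetric] inj)
  have carr: "central_idempotents G \<subseteq> carrier G" "central_idempotents H \<subseteq> h ` carrier G"
    by (auto simp: central_idempotents_def im)
  then have idem_im: "central_idempotents H = h ` central_idempotents G"
    using idem by blast
  have "h e \<in> central_atoms H \<longleftrightarrow> e \<in> central_atoms G" if e: "e \<in> carrier G" for e
  proof -
    have "(h f \<otimes>\<^bsub>H\<^esub> h e = h f \<longrightarrow> absorbing H (h f) \<or> h f = h e) \<longleftrightarrow>
          (f \<otimes>\<^bsub>G\<^esub> e = f \<longrightarrow> absorbing G f \<or> f = e)" if "f \<in> central_idempotents G" for f
      using that e carr by (simp add: subset_iff abs hom[symmetric] inj)
    then show ?thesis
      using e by (simp add: central_atoms_def idem abs) (simp add: idem_im)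
  qed
  moreover have "central_atoms G \<subseteq> carrier G" "central_atoms H \<subseteq> h ` carrier G"
    using carr by (auto simp: central_atoms_def)
  ultimately show ?thesis by blast
qed

section \<open>Peirce decomposition along a central idempotent\<close>

text \<open>For idempotent \<open>e\<close> the carrier is the right ideal \<open>eR\<close>. The
  element type of \<open>R\<close> is kept because \<open>directly_indecomposable\<close> quantifies
  over factors of that type.\<close>

definition corner_ring :: "('a, 'm) ring_scheme \<Rightarrow> 'a \<Rightarrow> 'a ring" where
  "corner_ring R e =
     \<lparr>carrier = {x \<in> carrier R. e \<otimes>\<^bsub>R\<^esub> x = x}, monoid.mult = (\<otimes>\<^bsub>R\<^esub>), one = e, ring.zero = \<zero>\<^bsub>R\<^esub>,
      ring.add = (\<oplus>\<^bsub>R\<^esub>)\<rparr>"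

text \<open>Idempotence puts the unit \<open>e\<close> into the carrier, and centrality makes it a
  unit on the right as well.\<close>

lemma (in ring) ring_corner_ring:
  assumes e: "e \<in> central_idempotents R"
  shows "ring (corner_ring R e)"
proof -
  have e': "e \<in> carrier R" "e \<otimes> e = e"
    using central_idempotentsD(1,2)[OF e] .
  show ?thesis
  proof (rule ringI)
    show "abelian_group (corner_ring R e)"
    proof (rule abelian_groupI)
      fix x y z assume "x \<in> carrier (corner_ring R e)" "y \<in> carrier (corner_ring R e)"
        "z \<in> carrier (corner_ring R e)"
      then show "x \<oplus>\<^bsub>corner_ring R e\<^esub> y \<oplus>\<^bsub>corner_ring R e\<^esub> z =
          x \<oplus>\<^bsub>corner_ring R e\<^esub> (y \<oplus>\<^bsub>corner_ring R e\<^esub> z)"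
        by (simp add: corner_ring_def a_assoc)
    next
      fix x y assume "x \<in> carrier (corner_ring R e)" "y \<in> carrier (corner_ring R e)"
      then show "x \<oplus>\<^bsub>corner_ring R e\<^esub> y = y \<oplus>\<^bsub>corner_ring R e\<^esub> x"
        by (simp add: corner_ring_def a_comm)
    next
      fix x assume "x \<in> carrier (corner_ring R e)"
      then show "\<exists>y\<in>carrier (corner_ring R e). y \<oplus>\<^bsub>corner_ring R e\<^esub> x = \<zero>\<^bsub>corner_ring R e\<^esub>"
        using e'(1) by (intro bexI[of _ "\<ominus> x"]) (simp_all add: corner_ring_def r_minus l_neg)
    qed (use e'(1) in \<open>simp_all add: corner_ring_def r_distr\<close>)
    show "monoid (corner_ring R e)"
    proof (rule monoidI)
      fix x y assume "x \<in> carrier (corner_ring R e)" "y \<in> carrier (corner_ring R e)"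
      then show "x \<otimes>\<^bsub>corner_ring R e\<^esub> y \<in> carrier (corner_ring R e)"
        using e' m_assoc[of e x y] by (simp add: corner_ring_def)
    next
      fix x assume "x \<in> carrier (corner_ring R e)"
      then show "x \<otimes>\<^bsub>corner_ring R e\<^esub> \<one>\<^bsub>corner_ring R e\<^esub> = x"
        using central_idempotentsD(3)[OF e, of x] by (simp add: corner_ring_def)
    qed (use e' in \<open>simp_all add: corner_ring_def m_assoc\<close>)
  qed (simp_all add: corner_ring_def l_distr r_distr)
qed

lemma (in ring) complement_central_idempotent:
  assumes e: "e \<in> central_idempotents R"
  shows "\<one> \<ominus> e \<in> central_idempotents R"
proof -
  have e': "e \<in> carrier R" "e \<otimes> e = e"
    using central_idempotentsD(1,2)[OF e] .
  have "(\<one> \<ominus> e) \<otimes> (\<one> \<ominus> e) = \<one> \<ominus> e"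
    using e' by (simp add: minus_eq l_distr r_distr l_minus r_minus l_neg r_neg)
  moreover have "(\<one> \<ominus> e) \<otimes> x = x \<otimes> (\<one> \<ominus> e)" if "x \<in> carrier R" for x
  proof -
    have "e \<otimes> x = x \<otimes> e" using central_idempotentsD(3)[OF e that] by simp
    then show ?thesis using e' that by (simp add: minus_eq l_distr r_distr l_minus r_minus)
  qed
  moreover have "\<one> \<ominus> e \<in> carrier R" using e' by simp
  ultimately show ?thesis unfolding central_idempotents_def by blast
qed

text \<open>Makes \<open>x \<mapsto> e \<otimes> x\<close> multiplicative, as both components of the
  Peirce map require: the inner \<open>e\<close> moves left past \<open>x\<close> and merges with
  the outer one.\<close>

lemma (in ring) central_idempotent_mult_mult:
  assumes e: "e \<in> central_idempotents R" and xy: "x \<in> carrier R" "y \<in> carrier R"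
  shows "(e \<otimes> x) \<otimes> (e \<otimes> y) = e \<otimes> (x \<otimes> y)"
proof -
  have e': "e \<in> carrier R" "e \<otimes> e = e" "x \<otimes> e = e \<otimes> x"
    using central_idempotentsD(1,2)[OF e] central_idempotentsD(3)[OF e xy(1)] .
  have "(e \<otimes> x) \<otimes> (e \<otimes> y) = e \<otimes> (x \<otimes> e) \<otimes> y"
    using e'(1) xy by (simp add: m_assoc)
  also have "\<dots> = (e \<otimes> e) \<otimes> x \<otimes> y"
    unfolding e'(3) using e'(1) xy by (simp add: m_assoc)
  finally show ?thesis using e' xy by (simp add: m_assoc)
qed

text \<open>The elements \<open>e\<close> and \<open>\<one> \<ominus> e\<close> are orthogonal
  central idempotents with sum \<open>\<one>\<close>. So \<open>x\<close> splits into its two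
  multiples, and addition of the components is the inverse map.\<close>

lemma (in ring) corner_ring_decomposition:
  assumes e: "e \<in> central_idempotents R"
  shows "R \<simeq> RDirProd (corner_ring R e) (corner_ring R (\<one> \<ominus> e))"
proof -
  define f where "f = \<one> \<ominus> e"
  have f: "f \<in> central_idempotents R"
    using complement_central_idempotent[OF e] by (simp add: f_def)
  have e': "e \<in> carrier R" "e \<otimes> e = e" and f': "f \<in> carrier R" "f \<otimes> f = f"
    using central_idempotentsD(1,2)[OF e] central_idempotentsD(1,2)[OF f] .
  have ef: "e \<otimes> f = \<zero>" "f \<otimes> e = \<zero>" "e \<oplus> f = \<one>"
    using e' by (simp_all add: f_def minus_eq l_distr r_distr l_minus r_minus r_neg a_lcomm[of e \<one>])
  have sum: "e \<otimes> x \<oplus> f \<otimes> x = x" if "x \<in> carrier R" for x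
    using that e' f' ef(3) by (simp flip: l_distr)
  have absorb: "e \<otimes> (e \<otimes> x) = e \<otimes> x" "f \<otimes> (f \<otimes> x) = f \<otimes> x" if "x \<in> carrier R" for x
    using that e' f' by (simp_all flip: m_assoc)
  let ?h = "\<lambda>x. (e \<otimes> x, f \<otimes> x)"
  have "?h \<in> ring_iso R (RDirProd (corner_ring R e) (corner_ring R f))"
  proof (rule ring_iso_memI)
    show "bij_betw ?h (carrier R) (carrier (RDirProd (corner_ring R e) (corner_ring R f)))"
    proof (rule bij_betwI[where g = "\<lambda>(a, b). a \<oplus> b"])
      fix p assume "p \<in> carrier (RDirProd (corner_ring R e) (corner_ring R f))"
      then obtain a b where p: "p = (a, b)" "a \<in> carrier R" "b \<in> carrier R" "e \<otimes> a = a" "f \<otimes> b = b"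
        by (auto simp: RDirProd_carrier corner_ring_def)
      \<comment> \<open>Orthogonality: \<open>b = f \<otimes> b\<close> gives
        \<open>e \<otimes> b = (e \<otimes> f) \<otimes> b = \<zero>\<close>, and symmetrically for
        \<open>a\<close>. Hence multiplying \<open>a \<oplus> b\<close> by \<open>e\<close> or
        \<open>f\<close> recovers the components.\<close>
      have "e \<otimes> b = \<zero>" "f \<otimes> a = \<zero>"
        using m_assoc[of e f b, symmetric] m_assoc[of f e a, symmetric] p e'(1) f'(1) ef by simp_all
      with p e'(1) f'(1) show "?h (case p of (a, b) \<Rightarrow> a \<oplus> b) = p"
        by (simp add: r_distr)
    qed (use e' f' sum absorb in \<open>auto simp: RDirProd_carrier corner_ring_def\<close>)
  qed (use e' f' absorb in \<open>simp_all add: RDirProd_def DirProd_def corner_ring_def r_distr monoid.defs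
      central_idempotent_mult_mult[OF e] central_idempotent_mult_mult[OF f]\<close>)
  then show ?thesis
    by (auto simp: is_ring_iso_def f_def)
qed

text \<open>Any further central idempotent would give two nonzero corners, since each corner
  contains its nonzero unit, and so a forbidden decomposition.\<close>

lemma directly_indecomposable_central_idempotents:
  fixes R (structure)
  assumes R: "directly_indecomposable R"
  shows "central_idempotents R = {\<zero>\<^bsub>R\<^esub>, \<one>\<^bsub>R\<^esub>}"
proof -
  interpret ring R
    using R by (simp add: directly_indecomposable_def nonzero_ring_def)
  have nz: "nonzero_ring (corner_ring R e)" if e: "e \<in> central_idempotents R" "e \<noteq> \<zero>" for e
  proof -
    have "e \<in> carrier (corner_ring R e)"
      using central_idempotentsD(1,2)[OF e(1)] by (simp add: corner_ring_def)
    moreover have "\<zero>\<^bsub>corner_ring R e\<^esub> = \<zero>" by (simp add: corner_ring_def)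
    ultimately show ?thesis
      using ring_corner_ring[OF e(1)] e(2) by (auto simp: nonzero_ring_def)
  qed
  have "e = \<zero> \<or> e = \<one>" if e: "e \<in> central_idempotents R" for e
  proof (rule ccontr)
    assume "\<not> (e = \<zero> \<or> e = \<one>)"
    moreover have "e \<in> carrier R" using central_idempotentsD(1)[OF e] .
    ultimately have "e \<noteq> \<zero>" "\<one> \<ominus> e \<noteq> \<zero>" by auto
    then show False
      using R corner_ring_decomposition[OF e] nz[OF e] nz[OF complement_central_idempotent[OF e]]
      unfolding directly_indecomposable_def by blast
  qed
  then show ?thesis by (auto simp: central_idempotents_def)
qed

lemma nonzero_ring_one_not_zero:
  assumes "nonzero_ring R"
  shows "\<one>\<^bsub>R\<^esub> \<noteq> \<zero>\<^bsub>R\<^esub>"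
proof -
  interpret ring R using assms by (simp add: nonzero_ring_def)
  show ?thesis using assms one_zeroD by (auto simp: nonzero_ring_def)
qed

section \<open>Central idempotents and atoms of a product\<close>

text \<open>Unlike \<open>factor_incl\<close>, the entries away from \<open>i\<close> are zero. For
  \<open>i\<close> outside \<open>I\<close> this is the zero tuple, so it lies in the product of the
  rings for every \<open>i\<close>.\<close>

definition factor_idempotent :: "'i set \<Rightarrow> ('i \<Rightarrow> ('a, 'm) ring_scheme) \<Rightarrow> 'i \<Rightarrow> 'i \<Rightarrow> 'a" where
  "factor_idempotent I R i = (\<lambda>k\<in>I. if k = i then \<one>\<^bsub>R k\<^esub> else \<zero>\<^bsub>R k\<^esub>)"

lemma factor_incl_carrier:
  assumes "\<And>k. k \<in> I \<Longrightarrow> monoid (M k)" "i \<in> I" "x \<in> carrier (M i)"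
  shows "factor_incl I M i x \<in> carrier (product_group I M)"
  using assms by (auto simp: factor_incl_def monoid.one_closed)

text \<open>Both conditions are equations between tuples with coordinatewise multiplication, so they
  can be checked in each factor, whatever the size of \<open>I\<close>.\<close>

lemma central_idempotents_product:
  assumes M: "\<And>i. i \<in> I \<Longrightarrow> monoid (M i)"
  shows "central_idempotents (product_group I M) = (\<Pi>\<^sub>E i\<in>I. central_idempotents (M i))"
proof
  show "central_idempotents (product_group I M) \<subseteq> (\<Pi>\<^sub>E i\<in>I. central_idempotents (M i))"
  proof
    fix e assume "e \<in> central_idempotents (product_group I M)"
    then have e: "e \<in> carrier (product_group I M)" "e \<otimes>\<^bsub>product_group I M\<^esub> e = e"
      "\<And>x. x \<in> carrier (product_group I M) \<Longrightarrow>
        e \<otimes>\<^bsub>product_group I M\<^esub> x = x \<otimes>\<^bsub>product_group I M\<^esub> e"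
      by (auto simp: central_idempotents_def)
    have "e i \<in> central_idempotents (M i)" if i: "i \<in> I" for i
    proof -
      \<comment> \<open>To test centrality in one factor, \<open>x\<close> is lifted to the product
        by filling the other coordinates with ones, and the tuple equation is read at
        \<open>i\<close>.\<close>
      have "e i \<otimes>\<^bsub>M i\<^esub> x = x \<otimes>\<^bsub>M i\<^esub> e i" if "x \<in> carrier (M i)" for x
        using fun_cong[OF e(3)[OF factor_incl_carrier[where M = M, OF M i that]], of i] i
        by (simp add: factor_incl_def)
      with fun_cong[OF e(2), of i] e(1) i show ?thesis
        by (auto simp: central_idempotents_def)
    qed
    with e(1) show "e \<in> (\<Pi>\<^sub>E i\<in>I. central_idempotents (M i))" by auto
  qed
  show "(\<Pi>\<^sub>E i\<in>I. central_idempotents (M i)) \<subseteq> central_idempotents (product_group I M)"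
  proof
    fix e assume e: "e \<in> (\<Pi>\<^sub>E i\<in>I. central_idempotents (M i))"
    then have ei: "e i \<in> carrier (M i)" "e i \<otimes>\<^bsub>M i\<^esub> e i = e i"
      "\<And>x. x \<in> carrier (M i) \<Longrightarrow> x \<otimes>\<^bsub>M i\<^esub> e i = e i \<otimes>\<^bsub>M i\<^esub> x" if "i \<in> I" for i
      using central_idempotentsD[of "e i" "M i"] that by (blast dest: PiE_mem)+
    have "e \<otimes>\<^bsub>product_group I M\<^esub> x = x \<otimes>\<^bsub>product_group I M\<^esub> e"
      if "x \<in> carrier (product_group I M)" for x
      using that ei(3) by (auto intro!: restrict_ext simp: PiE_iff)
    moreover have "e \<otimes>\<^bsub>product_group I M\<^esub> e = e"
      using e ei(2) by (intro extensionalityI[of _ I]) (simp_all add: PiE_iff)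
    moreover have "e \<in> carrier (product_group I M)"
      using e ei(1) by (simp add: PiE_iff)
    ultimately show "e \<in> central_idempotents (product_group I M)"
      unfolding central_idempotents_def by blast
  qed
qed

text \<open>An absorbing tuple equals its own product with the zero tuple, which is the zero
  tuple.\<close>

lemma absorbing_product:
  assumes R: "\<And>i. i \<in> I \<Longrightarrow> ring (R i)" and e: "e \<in> carrier (product_group I R)"
  shows "absorbing (product_group I R) e \<longleftrightarrow> e = (\<lambda>i\<in>I. \<zero>\<^bsub>R i\<^esub>)"
proof
  assume "absorbing (product_group I R) e"
  moreover have "(\<lambda>i\<in>I. \<zero>\<^bsub>R i\<^esub>) \<in> carrier (product_group I R)"
    using R by (simp add: ring.ring_simprules)
  ultimately have "e = e \<otimes>\<^bsub>product_group I R\<^esub> (\<lambda>i\<in>I. \<zero>\<^bsub>R i\<^esub>)"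
    unfolding absorbing_def by metis
  also have "\<dots> = (\<lambda>i\<in>I. \<zero>\<^bsub>R i\<^esub>)"
    using R e by (auto intro!: restrict_ext simp: PiE_iff ring.ring_simprules)
  finally show "e = (\<lambda>i\<in>I. \<zero>\<^bsub>R i\<^esub>)" .
next
  assume "e = (\<lambda>i\<in>I. \<zero>\<^bsub>R i\<^esub>)"
  then show "absorbing (product_group I R) e"
    using R by (auto intro!: restrict_ext simp: absorbing_def PiE_iff ring.ring_simprules)
qed

text \<open>The central idempotents are the tuples of zeros and ones, that is, indicators of subsets
  of \<open>I\<close>. Their order is inclusion, so the atoms are the indicators of
  singletons.\<close>

lemma central_atoms_product:
  assumes R: "\<And>i. i \<in> I \<Longrightarrow> directly_indecomposable (R i)"
  shows "central_atoms (product_group I R) = factor_idempotent I R ` I"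
proof -
  have ring: "ring (R i)" if "i \<in> I" for i
    using R[OF that] by (auto simp: directly_indecomposable_def nonzero_ring_def)
  have nz: "\<one>\<^bsub>R i\<^esub> \<noteq> \<zero>\<^bsub>R i\<^esub>" if "i \<in> I" for i
    using R[OF that] nonzero_ring_one_not_zero[of "R i"]
    by (auto simp: directly_indecomposable_def nonzero_ring_def)
  have simps: "monoid (R i)" "\<zero>\<^bsub>R i\<^esub> \<in> carrier (R i)" "\<one>\<^bsub>R i\<^esub> \<in> carrier (R i)"
    "\<And>x. x \<in> carrier (R i) \<Longrightarrow> \<zero>\<^bsub>R i\<^esub> \<otimes>\<^bsub>R i\<^esub> x = \<zero>\<^bsub>R i\<^esub>"
    "\<And>x. x \<in> carrier (R i) \<Longrightarrow> x \<otimes>\<^bsub>R i\<^esub> \<zero>\<^bsub>R i\<^esub> = \<zero>\<^bsub>R i\<^esub>"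
    "\<And>x. x \<in> carrier (R i) \<Longrightarrow> \<one>\<^bsub>R i\<^esub> \<otimes>\<^bsub>R i\<^esub> x = x"
    "\<And>x. x \<in> carrier (R i) \<Longrightarrow> x \<otimes>\<^bsub>R i\<^esub> \<one>\<^bsub>R i\<^esub> = x" if "i \<in> I" for i
    using ring[OF that] by (simp_all add: ring.is_monoid ring.ring_simprules monoid.r_one)
  let ?P = "product_group I R" and ?e = "factor_idempotent I R"
  define Z where "Z = (\<lambda>i\<in>I. \<zero>\<^bsub>R i\<^esub>)"
  have idem: "central_idempotents ?P = (\<Pi>\<^sub>E i\<in>I. {\<zero>\<^bsub>R i\<^esub>, \<one>\<^bsub>R i\<^esub>})"
    using central_idempotents_product[of I R] directly_indecomposable_central_idempotents[OF R] simps(1)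
    by (simp cong: PiE_cong)
  have abs: "absorbing ?P f \<longleftrightarrow> f = Z" if "f \<in> central_idempotents ?P" for f
    using absorbing_product[of I R f] ring that by (auto simp: central_idempotents_def Z_def)
  have e_idem: "?e i \<in> central_idempotents ?P" for i
    by (auto simp: idem factor_idempotent_def)
  have e_nz: "?e i \<noteq> Z" if "i \<in> I" for i
  proof
    assume "?e i = Z"
    from fun_cong[OF this, of i] show False
      using nz[OF that] that by (simp add: factor_idempotent_def Z_def)
  qed
  show ?thesis
  proof (intro equalityI subsetI)
    fix e assume e: "e \<in> central_atoms ?P"
    then have e01: "e \<in> (\<Pi>\<^sub>E i\<in>I. {\<zero>\<^bsub>R i\<^esub>, \<one>\<^bsub>R i\<^esub>})" and "e \<noteq> Z"
      using idem abs by (auto simp: central_atoms_def)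
    have "\<exists>i\<in>I. e i \<noteq> \<zero>\<^bsub>R i\<^esub>"
    proof (rule ccontr)
      assume "\<not> ?thesis"
      then have "e = Z" using e01 by (intro extensionalityI[of e I Z]) (auto simp: Z_def PiE_iff)
      with \<open>e \<noteq> Z\<close> show False ..
    qed
    then obtain i where i: "i \<in> I" "e i = \<one>\<^bsub>R i\<^esub>" using e01 by blast
    \<comment> \<open>At an index \<open>i\<close> in the support of the atom \<open>e\<close>, the
      singleton indicator \<open>?e i\<close> lies below \<open>e\<close>; minimality then forces
      equality.\<close>
    have "?e i k \<otimes>\<^bsub>R k\<^esub> e k = ?e i k" if "k \<in> I" for k
      using e01 i that simps[OF that] by (auto simp: factor_idempotent_def PiE_iff)
    then have "?e i \<otimes>\<^bsub>?P\<^esub> e = ?e i"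
      by (auto simp: factor_idempotent_def fun_eq_iff)
    then show "e \<in> ?e ` I"
      using e e_idem[of i] e_nz[OF i(1)] abs[OF e_idem] i(1) by (auto simp: central_atoms_def)
  next
    fix e assume "e \<in> ?e ` I"
    then obtain i where i: "i \<in> I" "e = ?e i" by blast
    have "f = Z \<or> f = ?e i" if f: "f \<in> (\<Pi>\<^sub>E i\<in>I. {\<zero>\<^bsub>R i\<^esub>, \<one>\<^bsub>R i\<^esub>})" "f \<otimes>\<^bsub>?P\<^esub> ?e i = f" for f
    proof -
      \<comment> \<open>Read at \<open>k \<noteq> i\<close>, the relation
        \<open>f \<otimes> ?e i = f\<close> says that \<open>f k\<close> is a multiple of
        zero.\<close>
      have "f k = \<zero>\<^bsub>R k\<^esub>" if k: "k \<in> I" "k \<noteq> i" for k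
      proof -
        have "f k \<in> carrier (R k)" using f(1) k simps[OF k(1)] by (auto simp: PiE_iff)
        then show ?thesis
          using fun_cong[OF f(2), of k] k simps[OF k(1)] by (simp add: factor_idempotent_def)
      qed
      moreover have "f i = \<zero>\<^bsub>R i\<^esub> \<or> f i = \<one>\<^bsub>R i\<^esub>" using f(1) i(1) by (auto simp: PiE_iff)
      moreover have "f k = undefined" if "k \<notin> I" for k using f(1) that by (auto simp: PiE_iff extensional_def)
      ultimately show ?thesis
        by (auto simp: Z_def factor_idempotent_def fun_eq_iff)
    qed
    then show "e \<in> central_atoms ?P"
      using e_idem[of i] e_nz[OF i(1)] abs i(2) by (auto simp: central_atoms_def simp flip: idem)
  qed
qed

section \<open>Index bijections and component maps of monomial isomorphisms\<close>

text \<open>The image of a nontrivial element of factor \<open>i\<close> would sit in two different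
  factors. Its coordinate \<open>\<sigma> i\<close> would then be one, against injectivity of
  \<open>\<phi> i\<close>.\<close>

lemma induced_by_bij_unique:
  assumes R: "\<And>i. i \<in> I \<Longrightarrow> monoid (R i)" and S: "\<And>j. j \<in> J \<Longrightarrow> monoid (S j)"
    and nontrivial: "\<And>i. i \<in> I \<Longrightarrow> carrier (R i) \<noteq> {\<one>\<^bsub>R i\<^esub>}"
    and \<sigma>: "induced_by I R J S \<Phi> \<sigma> \<phi>" and \<tau>: "induced_by I R J S \<Phi> \<tau> \<psi>" and i: "i \<in> I"
  shows "\<sigma> i = \<tau> i"
proof (rule ccontr)
  assume ne: "\<sigma> i \<noteq> \<tau> i"
  obtain x where x: "x \<in> carrier (R i)" "x \<noteq> \<one>\<^bsub>R i\<^esub>"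
    using nontrivial[OF i] monoid.one_closed[OF R[OF i]] by blast
  have j: "\<sigma> i \<in> J" and phi: "\<phi> i \<in> iso (R i) (S (\<sigma> i))"
    using \<sigma> i by (auto simp: induced_by_def bij_betw_def)
  have "factor_incl J S (\<sigma> i) (\<phi> i x) = factor_incl J S (\<tau> i) (\<psi> i x)"
    using \<sigma> \<tau> i x(1) by (simp add: induced_by_def)
  from fun_cong[OF this, of "\<sigma> i"] have "\<phi> i x = \<one>\<^bsub>S (\<sigma> i)\<^esub>"
    using j ne by (simp add: factor_incl_def)
  also have "\<dots> = \<phi> i \<one>\<^bsub>R i\<^esub>"
    using iso_monoid_one[OF R[OF i] S[OF j] phi] by simp
  finally show False
    using x phi monoid.one_closed[OF R[OF i]] by (auto simp: iso_def bij_betw_def inj_on_def)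
qed

text \<open>The component maps are forced: include, apply \<open>\<Phi>\<close>, project. Their
  injectivity comes from that of \<open>\<Phi>\<close> through the inclusion identity, their
  surjectivity from that of \<open>\<Phi>\<close> through the projection identity.\<close>

lemma induced_by_if_coordinatewise:
  assumes M: "\<And>i. i \<in> I \<Longrightarrow> monoid (M i)" and N: "\<And>j. j \<in> J \<Longrightarrow> monoid (N j)"
    and \<Phi>: "\<Phi> \<in> iso (product_group I M) (product_group J N)"
    and \<sigma>: "bij_betw \<sigma> I J"
    and coord: "\<And>i x y. \<lbrakk>i \<in> I; x \<in> carrier (product_group I M); y \<in> carrier (product_group I M);
      x i = y i\<rbrakk> \<Longrightarrow> \<Phi> x (\<sigma> i) = \<Phi> y (\<sigma> i)"
  shows "induced_by I M J N \<Phi> \<sigma> (\<lambda>i a. \<Phi> (factor_incl I M i a) (\<sigma> i))"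
proof -
  let ?P = "product_group I M" and ?Q = "product_group J N"
  define \<phi> where "\<phi> = (\<lambda>i a. \<Phi> (factor_incl I M i a) (\<sigma> i))"
  have hom: "\<Phi> (x \<otimes>\<^bsub>?P\<^esub> y) = \<Phi> x \<otimes>\<^bsub>?Q\<^esub> \<Phi> y" if "x \<in> carrier ?P" "y \<in> carrier ?P" for x y
    using \<Phi> that unfolding iso_def hom_def by blast
  have inj: "inj_on \<Phi> (carrier ?P)" and im: "\<Phi> ` carrier ?P = carrier ?Q"
    using \<Phi> by (auto simp: iso_def bij_betw_def)
  have \<sigma>J: "\<sigma> i \<in> J" if "i \<in> I" for i using \<sigma> that by (auto simp: bij_betw_def)
  have one: "\<Phi> \<one>\<^bsub>?P\<^esub> = \<one>\<^bsub>?Q\<^esub>"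
    using iso_monoid_one[OF product_group_monoid product_group_monoid \<Phi>] M N by blast
  note incl = factor_incl_carrier[of I M, OF M]
  have incl_at: "factor_incl I M i a i = a" if "i \<in> I" for i a
    using that by (simp add: factor_incl_def)
  \<comment> \<open>The tuple \<open>x\<close> and the inclusion of \<open>x i\<close> agree at
    \<open>i\<close>, so \<open>coord\<close> applies.\<close>
  have proj: "\<Phi> x (\<sigma> i) = \<phi> i (x i)" if "i \<in> I" "x \<in> carrier ?P" for i x
    unfolding \<phi>_def using that by (intro coord incl) (auto simp: incl_at)
  have Q: "\<Phi> x \<in> carrier ?Q" if "x \<in> carrier ?P" for x using im that by blast
  have incl_eq: "\<Phi> (factor_incl I M i a) = factor_incl J N (\<sigma> i) (\<phi> i a)"
    if i: "i \<in> I" and a: "a \<in> carrier (M i)" for i a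
  proof (rule PiE_ext)
    show "\<Phi> (factor_incl I M i a) \<in> (\<Pi>\<^sub>E j\<in>J. carrier (N j))"
      using Q[OF incl[OF _ i a]] by simp
    show "factor_incl J N (\<sigma> i) (\<phi> i a) \<in> (\<Pi>\<^sub>E j\<in>J. carrier (N j))"
    proof -
      have "\<phi> i a \<in> carrier (N (\<sigma> i))"
        using Q[OF incl[OF _ i a]] \<sigma>J[OF i] by (auto simp: \<phi>_def)
      then show ?thesis using factor_incl_carrier[of J N "\<sigma> i"] N \<sigma>J[OF i] by simp
    qed
    fix j assume "j \<in> J"
    then obtain k where k: "k \<in> I" "j = \<sigma> k" using \<sigma> by (auto simp: bij_betw_def)
    show "\<Phi> (factor_incl I M i a) j = factor_incl J N (\<sigma> i) (\<phi> i a) j"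
    proof (cases "k = i")
      case True
      then show ?thesis using k \<sigma>J[OF i] by (simp add: factor_incl_def \<phi>_def)
    next
      case False
      then have "\<sigma> k \<noteq> \<sigma> i" using \<sigma> k i by (auto simp: bij_betw_def inj_on_def)
      \<comment> \<open>At \<open>k \<noteq> i\<close> the inclusion has entry one, so by
        \<open>coord\<close> it can be replaced by the identity tuple, which \<open>\<Phi>\<close>
        preserves.\<close>
      moreover have "\<Phi> (factor_incl I M i a) (\<sigma> k) = \<Phi> \<one>\<^bsub>?P\<^esub> (\<sigma> k)"
        using False k(1) incl[OF _ i a] monoid.one_closed[OF product_group_monoid, of I M] M
        by (intro coord) (auto simp: factor_incl_def)
      ultimately show ?thesis using one k \<sigma>J[OF k(1)] by (simp add: factor_incl_def)
    qed
  qed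
  have "\<phi> i \<in> iso (M i) (N (\<sigma> i))" if i: "i \<in> I" for i
  proof (rule isoI)
    show "\<phi> i \<in> hom (M i) (N (\<sigma> i))"
    proof (rule homI)
      fix a assume a: "a \<in> carrier (M i)"
      show "\<phi> i a \<in> carrier (N (\<sigma> i))"
        using Q[OF incl[OF _ i a]] \<sigma>J[OF i] by (auto simp: \<phi>_def)
      fix b assume b: "b \<in> carrier (M i)"
      let ?a = "factor_incl I M i a" and ?b = "factor_incl I M i b"
      have ab: "?a \<in> carrier ?P" "?b \<in> carrier ?P" using incl[OF _ i] a b by auto
      then have "?a \<otimes>\<^bsub>?P\<^esub> ?b \<in> carrier ?P"
        using monoid.m_closed[OF product_group_monoid, of I M] M by blast
      \<comment> \<open>The product tuple has entry \<open>a \<otimes> b\<close> at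
        \<open>i\<close>, so \<open>proj\<close> applies to it directly and multiplicativity of
        \<open>factor_incl\<close> is not called for.\<close>
      from proj[OF i this] show "\<phi> i (a \<otimes>\<^bsub>M i\<^esub> b) = \<phi> i a \<otimes>\<^bsub>N (\<sigma> i)\<^esub> \<phi> i b"
        using i \<sigma>J[OF i] hom[OF ab] by (simp add: incl_at \<phi>_def)
    qed
    show "bij_betw (\<phi> i) (carrier (M i)) (carrier (N (\<sigma> i)))"
    proof (rule bij_betw_imageI)
      show "inj_on (\<phi> i) (carrier (M i))"
      proof (rule inj_onI)
        fix a b assume ab: "a \<in> carrier (M i)" "b \<in> carrier (M i)" "\<phi> i a = \<phi> i b"
        then have "\<Phi> (factor_incl I M i a) = \<Phi> (factor_incl I M i b)"
          using incl_eq[OF i] by simp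
        then have "factor_incl I M i a = factor_incl I M i b"
          using inj_onD[OF inj] incl[OF _ i] ab(1,2) by blast
        then show "a = b" using incl_at[OF i] by metis
      qed
      show "\<phi> i ` carrier (M i) = carrier (N (\<sigma> i))"
      proof (intro equalityI subsetI)
        fix b assume b: "b \<in> carrier (N (\<sigma> i))"
        then have "factor_incl J N (\<sigma> i) b \<in> carrier ?Q"
          using factor_incl_carrier[of J N "\<sigma> i"] N \<sigma>J[OF i] by blast
        then obtain y where y: "y \<in> carrier ?P" "\<Phi> y = factor_incl J N (\<sigma> i) b"
          using im by (metis imageE)
        \<comment> \<open>Only the entry of \<open>y\<close> at \<open>i\<close> matters here;
          \<open>y\<close> is not assumed to be an inclusion.\<close>
        have "b = \<phi> i (y i)"
          using proj[OF i y(1)] y(2) \<sigma>J[OF i] by (simp add: factor_incl_def)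
        moreover have "y i \<in> carrier (M i)" using y(1) i by auto
        ultimately show "b \<in> \<phi> i ` carrier (M i)" by blast
      qed (use Q incl[OF _ i] \<sigma>J[OF i] in \<open>fastforce simp: \<phi>_def\<close>)
    qed
  qed
  with incl_eq proj \<sigma> show ?thesis
    unfolding induced_by_def \<phi>_def by blast
qed

lemma factor_idempotent_inj:
  assumes "\<And>i. i \<in> I \<Longrightarrow> \<one>\<^bsub>R i\<^esub> \<noteq> \<zero>\<^bsub>R i\<^esub>"
  shows "inj_on (factor_idempotent I R) I"
proof (rule inj_onI)
  fix i k assume i: "i \<in> I" and eq: "factor_idempotent I R i = factor_idempotent I R k"
  from fun_cong[OF eq, of i] show "i = k"
    using i assms[OF i] by (simp add: factor_idempotent_def split: if_splits)
qed

section \<open>The bijection of atoms and the monomial form of \<open>\<Phi>\<close>\<close>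

theorem corollary4p3:
  fixes I :: "'i set" and J :: "'j set"
    and R :: "'i \<Rightarrow> ('a, 'm) ring_scheme" and S :: "'j \<Rightarrow> ('b, 'n) ring_scheme"
    and \<Phi> :: "('i \<Rightarrow> 'a) \<Rightarrow> ('j \<Rightarrow> 'b)"
  assumes "\<And>i. i \<in> I \<Longrightarrow> directly_indecomposable (R i)"
    and "\<And>j. j \<in> J \<Longrightarrow> directly_indecomposable (S j)"
    and "\<Phi> \<in> iso (product_group I R) (product_group J S)"
  shows "monomial_iso I R J S \<Phi> \<and> I \<approx> J \<and>
    (\<exists>!\<sigma>. \<sigma> \<in> I \<rightarrow>\<^sub>E J \<and> bij_betw \<sigma> I J \<and> (\<exists>\<phi>. induced_by I R J S \<Phi> \<sigma> \<phi>))"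
proof -
  let ?P = "product_group I R" and ?Q = "product_group J S"
  let ?e = "factor_idempotent I R" and ?f = "factor_idempotent J S"
  have R: "ring (R i)" "\<one>\<^bsub>R i\<^esub> \<noteq> \<zero>\<^bsub>R i\<^esub>" if "i \<in> I" for i
    using assms(1)[OF that] nonzero_ring_one_not_zero[of "R i"]
    by (auto simp: directly_indecomposable_def nonzero_ring_def)
  have S: "ring (S j)" "\<one>\<^bsub>S j\<^esub> \<noteq> \<zero>\<^bsub>S j\<^esub>" if "j \<in> J" for j
    using assms(2)[OF that] nonzero_ring_one_not_zero[of "S j"]
    by (auto simp: directly_indecomposable_def nonzero_ring_def)
  have RM: "monoid (R i)" if "i \<in> I" for i using R(1)[OF that] by (rule ring.is_monoid)
  have SM: "monoid (S j)" if "j \<in> J" for j using S(1)[OF that] by (rule ring.is_monoid)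
  have e_carrier: "?e i \<in> carrier ?P" for i
    using R(1) by (auto simp: factor_idempotent_def ring.ring_simprules)
  have \<Phi>_inj: "inj_on \<Phi> (carrier ?P)" and \<Phi>_im: "\<Phi> ` carrier ?P = carrier ?Q"
    using assms(3) by (auto simp: iso_def bij_betw_def)
  have "\<Phi> ` ?e ` I = ?f ` J"
    using iso_image_central_atoms[OF product_group_monoid assms(3)] RM
      central_atoms_product[where R = R, OF assms(1)] central_atoms_product[where R = S, OF assms(2)]
    by simp
  moreover have "inj_on (\<Phi> \<circ> ?e) I"
    using factor_idempotent_inj[of I R] R(2) e_carrier
    by (intro comp_inj_on inj_on_subset[OF \<Phi>_inj]) auto
  ultimately have "bij_betw (\<Phi> \<circ> ?e) I (?f ` J)"
    by (simp add: bij_betw_def image_comp)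
  moreover have "bij_betw (inv_into J ?f) (?f ` J) J"
    using factor_idempotent_inj[of J S] S(2) by (intro bij_betw_inv_into inj_on_imp_bij_betw) auto
  ultimately have bij: "bij_betw (inv_into J ?f \<circ> (\<Phi> \<circ> ?e)) I J"
    by (rule bij_betw_trans)
  \<comment> \<open>The index \<open>\<sigma> i\<close> is read off from the atom
    \<open>\<Phi> (?e i)\<close>. Restriction to \<open>I\<close> fixes the values outside
    \<open>I\<close>, so that uniqueness can be stated as equality of functions.\<close>
  define \<sigma> where "\<sigma> = restrict (inv_into J ?f \<circ> (\<Phi> \<circ> ?e)) I"
  have \<sigma>: "bij_betw \<sigma> I J"
    using bij by (simp add: \<sigma>_def cong: bij_betw_cong)
  have \<sigma>E: "\<sigma> \<in> I \<rightarrow>\<^sub>E J"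
    using \<sigma> by (auto simp: bij_betw_def \<sigma>_def)
  have \<Phi>_e: "\<Phi> (?e i) = ?f (\<sigma> i)" if "i \<in> I" for i
  proof -
    have "\<Phi> (?e i) \<in> ?f ` J" using \<open>\<Phi> ` ?e ` I = ?f ` J\<close> that by blast
    from f_inv_into_f[OF this] show ?thesis using that by (simp add: \<sigma>_def)
  qed
  \<comment> \<open>Multiplication by \<open>?f (\<sigma> i)\<close> leaves the coordinate
    \<open>\<sigma> i\<close> unchanged, and \<open>?f (\<sigma> i)\<close> is the image of
    \<open>?e i\<close>.\<close>
  have recover: "\<Phi> x (\<sigma> i) = \<Phi> (?e i \<otimes>\<^bsub>?P\<^esub> x) (\<sigma> i)" if i: "i \<in> I" and x: "x \<in> carrier ?P" for i x
  proof -
    have j: "\<sigma> i \<in> J" using \<sigma>E i by blast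
    have "\<Phi> x \<in> carrier ?Q" using \<Phi>_im x by blast
    then have "\<Phi> x (\<sigma> i) \<in> carrier (S (\<sigma> i))" using j by auto
    then have "\<Phi> x (\<sigma> i) = (?f (\<sigma> i) \<otimes>\<^bsub>?Q\<^esub> \<Phi> x) (\<sigma> i)"
      using j SM[OF j] by (simp add: factor_idempotent_def monoid.l_one)
    also have "?f (\<sigma> i) \<otimes>\<^bsub>?Q\<^esub> \<Phi> x = \<Phi> (?e i \<otimes>\<^bsub>?P\<^esub> x)"
      using assms(3) e_carrier[of i] x \<Phi>_e[OF i] unfolding iso_def hom_def by force
    finally show ?thesis .
  qed
  have coord: "\<Phi> x (\<sigma> i) = \<Phi> y (\<sigma> i)"
    if i: "i \<in> I" and xy: "x \<in> carrier ?P" "y \<in> carrier ?P" "x i = y i" for i x y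
  proof -
    \<comment> \<open>Multiplying by \<open>?e i\<close> erases all entries except the one at
      \<open>i\<close>, where \<open>x\<close> and \<open>y\<close> agree.\<close>
    have "?e i k \<otimes>\<^bsub>R k\<^esub> x k = ?e i k \<otimes>\<^bsub>R k\<^esub> y k" if "k \<in> I" for k
      using that xy R(1)[OF that] by (auto simp: factor_idempotent_def PiE_iff ring.ring_simprules)
    then have "?e i \<otimes>\<^bsub>?P\<^esub> x = ?e i \<otimes>\<^bsub>?P\<^esub> y" by (simp cong: restrict_cong)
    then show ?thesis using recover[OF i] xy by simp
  qed
  have ind: "\<exists>\<phi>. induced_by I R J S \<Phi> \<sigma> \<phi>"
    using induced_by_if_coordinatewise[OF RM SM assms(3) \<sigma> coord] by blast
  \<comment> \<open>The zero is an element other than one.\<close>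
  have nontrivial: "carrier (R i) \<noteq> {\<one>\<^bsub>R i\<^esub>}" if "i \<in> I" for i
    using R[OF that] ring.ring_simprules(2)[of "R i"] by auto
  have unique: "\<tau> = \<sigma>" if \<tau>: "\<tau> \<in> I \<rightarrow>\<^sub>E J" "\<exists>\<phi>. induced_by I R J S \<Phi> \<tau> \<phi>" for \<tau>
  proof (rule PiE_ext[OF \<tau>(1) \<sigma>E])
    obtain \<phi> \<psi> where "induced_by I R J S \<Phi> \<tau> \<phi>" "induced_by I R J S \<Phi> \<sigma> \<psi>"
      using \<tau>(2) ind by blast
    then show "\<tau> i = \<sigma> i" if "i \<in> I" for i
      using that
      by (rule induced_by_bij_unique[where R = R and S = S, rotated 3]) (simp_all add: RM SM nontrivial)
  qed
  have "\<exists>!\<sigma>. \<sigma> \<in> I \<rightarrow>\<^sub>E J \<and> bij_betw \<sigma> I J \<and> (\<exists>\<phi>. induced_by I R J S \<Phi> \<sigma> \<phi>)"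
  proof (rule ex1I[of _ \<sigma>])
    show "\<sigma> \<in> I \<rightarrow>\<^sub>E J \<and> bij_betw \<sigma> I J \<and> (\<exists>\<phi>. induced_by I R J S \<Phi> \<sigma> \<phi>)"
      by (intro conjI \<sigma>E \<sigma> ind)
  qed (elim conjE, rule unique)
  moreover have "monomial_iso I R J S \<Phi>"
    unfolding monomial_iso_def using assms(3) ind by blast
  moreover have "I \<approx> J"
    unfolding eqpoll_def using \<sigma> by blast
  ultimately show ?thesis by (intro conjI)
qed

end
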